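(* Let $k>0$, let $m=m_{1/k}=(\Gamma(1+p/k))_{p\ge0}$ and let $\overline{\mathbb M}$ be a strongly regular sequence. Then the following (Assumption (A) for $m_1=m$) holds for every direction $d\in\mathbb R$: for every complex Banach space $\mathbb F$ and every formal power series $\hat u(t)\in\mathbb F[[t]]$ which is $\overline{\mathbb M}$-summable along direction $d$ with $\overline{\mathbb M}$-sum $u(t)$, the formal power series $\partial_{m,t}^{-1}\hat u(t)$ is $\overline{\mathbb M}$-summable along direction $d$, and its $\overline{\mathbb M}$-sum $F_d(t)$ along direction $d$ satisfies $\partial_{m,t}F_d(t)=u(t)$.
   Context: **Strongly regular sequences.** An increasing sequence of positive reals $\mathbb M=(M_p)_{p\ge0}$ with $M_0=1$ is strongly regular if: (lc) $M_p^2\le M_{p-1}M_{p+1}$ for all $p\ge1$; (mg) there is $A_1>0$ with $M_{p+q}\le A_1^{p+q}M_pM_q$ for all $p,q\ge0$; (snq) there is $A_2>0$ with $\sum_{q\ge p}\frac{M_q}{(q+1)M_{q+1}}\le A_2\frac{M_p}{M_{p+1}}$ for all $p\ge0$. Put $M(t)=\sup_{p\ge0}\log(t^p/M_p)$ for $t>0$, $M(0)=0$, and $\omega(\mathbb M)=\big(\limsup_{r\to\infty}\max\{0,\frac{\log M(r)}{\log r}\}\big)^{-1}\in(0,\infty)$. **Sectors and summability.** $S_d(\theta)=\{z:|\arg z-d|<\theta/2\}$ on the Riemann surface of the logarithm, $S_d(\theta;r)=S_d(\theta)\cap D(0,r)$, where $D(0,r)=\{|z|<r\}$. A sectorial region $G_d(\theta)$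 is a domain contained in $S_d(\theta;r)$ for some $r>0$ and such that for every $0<\theta'<\theta$ it contains $S_d(\theta';r')$ for some $r'>0$. Let $\mathbb F$ be a complex Banach space and $\mathbb M=(M_p)$ strongly regular. A holomorphic $u:G_d(\theta)\to\mathbb F$ has $\hat u=\sum a_pz^p\in\mathbb F[[z]]$ as $\mathbb M$-asymptotic expansion in $G_d(\theta)$ if for every $0<\theta'<\theta$ and $r'>0$ with $S_d(\theta';r')\subseteq G_d(\theta)$ there are $C,A>0$ such that $\|u(z)-\sum_{p=0}^{N-1}a_pz^p\|\le CA^NM_N|z|^N$ for all $N\ge1$ and $z\in S_d(\theta';r')$. The series $\hat u$ is $\mathbb M$-summable along direction $d$ if such a $u$ exists on some sectorial region $G_d(\theta)$ with $\theta>\pi\omega(\mathbb M)$; $u$ is then unique and called the $\mathbb M$-sum of $\hat u$ along $d$. **Moment operators.** For a sequence $m=(m(p))_{p\ge0}$ of positive reals, on formal power series: $\partial_{m,t}\big(\sum_p\frac{a_p}{m(p)}t^p\big)=\sum_p\frac{a_{p+1}}{m(p)}t^p$, and $\partial_{m,t}^{-1}$ is the linear operator with $\partial_{m,t}^{-1}(t^p)=\frac{m(p)}{m(p+1)}t^{p+1}$ for all $p\ge0$. If $u(t)$ is the $\mathbb M$-sum along $d$ of $\hat u(t)$, then $\partial_{m,t}u$ is defined as the $\mathbb M$-sum along $d$ of the series $\partial_{m,t}\hat u(t)$ (when that series is $\mathbb M$-summable along $d$). *)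

theory Defs
  imports "HOL-Analysis.Analysis" "HOL-Computational_Algebra.Formal_Power_Series"
begin

class complex_banach = banach +
  fixes scaleC :: "complex \<Rightarrow> 'a \<Rightarrow> 'a"  (infixr "*\<^sub>C" 75)
  assumes scaleC_of_real: "of_real r *\<^sub>C x = r *\<^sub>R x"
    and scaleC_add_right: "a *\<^sub>C (x + y) = a *\<^sub>C x + a *\<^sub>C y"
    and scaleC_add_left: "(a + b) *\<^sub>C x = a *\<^sub>C x + b *\<^sub>C x"
    and scaleC_scaleC: "a *\<^sub>C (b *\<^sub>C x) = (a * b) *\<^sub>C x"
    and norm_scaleC: "norm (a *\<^sub>C x) = cmod a * norm x"

instantiation complex :: complex_banach
begin

definition scaleC_complex :: "complex \<Rightarrow> complex \<Rightarrow> complex" where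
  "scaleC_complex a x = a * x"

instance
  by standard (simp_all add: scaleC_complex_def algebra_simps norm_mult scaleR_conv_of_real)

end

text \<open>Complex differentiability at every point, for functions with values in a complex Banach
  space; it is only used on open sets.\<close>

definition holomorphic_into :: "(complex \<Rightarrow> 'f::complex_banach) \<Rightarrow> complex set \<Rightarrow> bool" where
  "holomorphic_into u G \<longleftrightarrow> (\<forall>w\<in>G. \<exists>D. (u has_derivative (\<lambda>h. h *\<^sub>C D)) (at w))"

text \<open>In \<open>snq\<close> the summation index is shifted to start at 0. Increasing means nondecreasing:
  the Gevrey sequences \<open>(fact p) powr \<alpha>\<close> have equal entries at 0 and 1.\<close>

definition strongly_regular :: "(nat \<Rightarrow> real) \<Rightarrow> bool" where
  "strongly_regular M \<longleftrightarrow>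
     (\<forall>p. M p > 0) \<and> mono M \<and> M 0 = 1 \<and>
     (\<forall>p\<ge>1. (M p)\<^sup>2 \<le> M (p - 1) * M (p + 1)) \<and>
     (\<exists>A1>0. \<forall>p q. M (p + q) \<le> A1 ^ (p + q) * M p * M q) \<and>
     (\<exists>A2>0. \<forall>p.
        summable (\<lambda>j. M (p + j) / (real (p + j + 1) * M (p + j + 1))) \<and>
        (\<Sum>j. M (p + j) / (real (p + j + 1) * M (p + j + 1))) \<le> A2 * (M p / M (p + 1)))"

text \<open>For strongly regular \<open>M\<close> the supremum below is over a set that is bounded above, since
  \<open>snq\<close> and \<open>lc\<close> force \<open>M p / M (p + 1)\<close> to tend to 0.\<close>

definition assoc_fun :: "(nat \<Rightarrow> real) \<Rightarrow> real \<Rightarrow> real" where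
  "assoc_fun M t = (if t = 0 then 0 else (SUP p. ln (t ^ p / M p)))"

definition growth_index :: "(nat \<Rightarrow> real) \<Rightarrow> ereal" where
  "growth_index M =
     inverse (Limsup at_top (\<lambda>r::real. ereal (max 0 (ln (assoc_fun M r) / ln r))))"

text \<open>The Riemann surface of the logarithm is represented by its global chart \<open>w = log z\<close>: a point
  \<open>z\<close> is given by the complex number \<open>w\<close> with \<open>\<bar>z\<bar> = exp (Re w)\<close> and \<open>arg z = Im w\<close>, and its
  projection to the punctured plane is \<open>exp w\<close>. As this projection is locally biholomorphic,
  holomorphy in \<open>z\<close> and in \<open>w\<close> coincide.\<close>

definition bounded_sector :: "real \<Rightarrow> real \<Rightarrow> real \<Rightarrow> complex set" where
  "bounded_sector d \<theta> r = {w. \<bar>Im w - d\<bar> < \<theta> / 2 \<and> exp (Re w) < r}"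

definition sectorial_region :: "real \<Rightarrow> real \<Rightarrow> complex set \<Rightarrow> bool" where
  "sectorial_region d \<theta> G \<longleftrightarrow>
     \<theta> > 0 \<and> open G \<and> connected G \<and>
     (\<exists>r>0. G \<subseteq> bounded_sector d \<theta> r) \<and>
     (\<forall>\<theta>'. 0 < \<theta>' \<and> \<theta>' < \<theta> \<longrightarrow> (\<exists>r'>0. bounded_sector d \<theta>' r' \<subseteq> G))"

definition asymptotic_expansion ::
  "(nat \<Rightarrow> real) \<Rightarrow> real \<Rightarrow> real \<Rightarrow> complex set \<Rightarrow> (complex \<Rightarrow> 'f::complex_banach) \<Rightarrow> 'f fps \<Rightarrow> bool"
where
  "asymptotic_expansion M d \<theta> G u f \<longleftrightarrow>
     (\<forall>\<theta>' r'. 0 < \<theta>' \<and> \<theta>' < \<theta> \<and> r' > 0 \<and> bounded_sector d \<theta>' r' \<subseteq> G \<longrightarrow>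
        (\<exists>C>0. \<exists>A>0. \<forall>N\<ge>1. \<forall>w\<in>bounded_sector d \<theta>' r'.
           norm (u w - (\<Sum>p<N. (exp w) ^ p *\<^sub>C fps_nth f p))
             \<le> C * A ^ N * M N * cmod (exp w) ^ N))"

text \<open>\<open>is_msum M d f G u\<close>: the function \<open>u\<close> on \<open>G\<close> is the \<open>M\<close>-sum of \<open>f\<close> along \<open>d\<close>.\<close>

definition is_msum ::
  "(nat \<Rightarrow> real) \<Rightarrow> real \<Rightarrow> 'f::complex_banach fps \<Rightarrow> complex set \<Rightarrow> (complex \<Rightarrow> 'f) \<Rightarrow> bool" where
  "is_msum M d f G u \<longleftrightarrow>
     (\<exists>\<theta>. ereal \<theta> > ereal pi * growth_index M \<and> sectorial_region d \<theta> G \<and>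
          holomorphic_into u G \<and> asymptotic_expansion M d \<theta> G u f)"

definition msummable :: "(nat \<Rightarrow> real) \<Rightarrow> real \<Rightarrow> 'f::complex_banach fps \<Rightarrow> bool" where
  "msummable M d f \<longleftrightarrow> (\<exists>G u. is_msum M d f G u)"

text \<open>Writing a series as \<open>\<Sum>p. (a p / m p) t^p\<close>, the sequence \<open>a\<close> is \<open>a p = m p * fps_nth f p\<close>.\<close>

definition moment_deriv :: "(nat \<Rightarrow> real) \<Rightarrow> 'f::real_vector fps \<Rightarrow> 'f fps" where
  "moment_deriv m f = Abs_fps (\<lambda>p. (1 / m p) *\<^sub>R (m (p + 1) *\<^sub>R fps_nth f (p + 1)))"

definition moment_integral :: "(nat \<Rightarrow> real) \<Rightarrow> 'f::real_vector fps \<Rightarrow> 'f fps" where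
  "moment_integral m f =
     Abs_fps (\<lambda>n. case n of 0 \<Rightarrow> 0 | Suc p \<Rightarrow> (m p / m (p + 1)) *\<^sub>R fps_nth f p)"

text \<open>The moment derivative of the function \<open>U\<close> on \<open>G\<close> is the function \<open>V\<close> on \<open>H\<close>. It is a relation
  because sums along a direction are determined only up to the choice of the sectorial region.\<close>

definition has_moment_deriv ::
  "(nat \<Rightarrow> real) \<Rightarrow> (nat \<Rightarrow> real) \<Rightarrow> real \<Rightarrow> complex set \<Rightarrow> (complex \<Rightarrow> 'f::complex_banach) \<Rightarrow>
   complex set \<Rightarrow> (complex \<Rightarrow> 'f) \<Rightarrow> bool" where
  "has_moment_deriv M m d G U H V \<longleftrightarrow>
     (\<exists>f. is_msum M d f G U \<and> is_msum M d (moment_deriv m f) H V)"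

definition gamma_moment :: "real \<Rightarrow> nat \<Rightarrow> real" where
  "gamma_moment k p = Gamma (1 + real p / k)"

end

theory Submission imports Defs "HOL-Complex_Analysis.Complex_Analysis" begin

text \<open>Since \<open>m p / m (p + 1) = B(1 + p/k, 1/k) / \<Gamma>(1/k)\<close>, the operator \<open>\<partial>\<^sub>m\<close> has the inverse
  \<open>F(z) = z / \<Gamma>(1/k) \<integral> u(z s\<^bsup>1/k\<^esup>) (1 - s)\<^bsup>1/k - 1\<^esup> ds\<close> (integral over \<open>[0, 1]\<close>), which only involves \<open>u\<close> on
  the segment from 0 to \<open>z\<close> and hence makes sense on any bounded sector contained in the region
  of \<open>u\<close>. Integrating the remainder estimates of \<open>u\<close> of order \<open>N - 1\<close> gives those of \<open>F\<close> of order
  \<open>N\<close>, because \<open>M\<close> is nondecreasing. Holomorphy of \<open>F\<close> follows from a second order Taylor bound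
  for \<open>u\<close> that is uniform along the segment; it reduces to the scalar Cauchy estimates by means of
  norming functionals.\<close>

subsection \<open>Norming functionals\<close>

text \<open>Homogeneity is asked only as an inequality for \<open>c > 0\<close>, the form that
  passes to infima; equality for all \<open>c \<ge> 0\<close> follows. The bound by the norm also
  yields \<open>p x \<ge> - norm x\<close>, so pointwise infima are finite.\<close>

definition dominated_sublinear :: "('a::real_normed_vector \<Rightarrow> real) \<Rightarrow> bool" where
  "dominated_sublinear p \<longleftrightarrow>
     (\<forall>x y. p (x + y) \<le> p x + p y) \<and> (\<forall>c x. c > 0 \<longrightarrow> p (c *\<^sub>R x) \<le> c * p x) \<and>
     (\<forall>x. p x \<le> norm x)"

lemma dominated_sublinearD:
  assumes "dominated_sublinear p"
  shows "p (x + y) \<le> p x + p y" "p x \<le> norm x" "- p (- x) \<le> p x" "p 0 = 0"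
    and "c \<ge> 0 \<Longrightarrow> p (c *\<^sub>R x) = c * p x"
proof -
  note a = assms[unfolded dominated_sublinear_def]
  show add: "p (x + y) \<le> p x + p y" for x y using a by blast
  show "p x \<le> norm x" using a by blast
  have "p 0 \<le> norm (0::'a)" using a by blast
  with add[of 0 0] show p0: "p 0 = 0" by simp
  show "- p (- x) \<le> p x" using add[of x "- x"] p0 by simp
  have le: "p (c *\<^sub>R x) \<le> c * p x" if "c > 0" for c x using a that by blast
  show "p (c *\<^sub>R x) = c * p x" if "c \<ge> 0"
  proof (cases "c = 0")
    case False
    with that have c: "c > 0" by simp
    have "c * p x \<le> p (c *\<^sub>R x)"
      using le[of "1 / c" "c *\<^sub>R x"] c by (simp add: field_simps)
    with le[OF c, of x] show ?thesis by simp
  qed (simp add: p0)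
qed

text \<open>Largest sublinear functional below \<open>p\<close> whose value at \<open>- a\<close> is at most \<open>- p a\<close>. A minimal
  sublinear \<open>p\<close> equals all its tilts, and this forces \<open>p\<close> to be additive.\<close>

definition tilt :: "('a::real_normed_vector \<Rightarrow> real) \<Rightarrow> 'a \<Rightarrow> 'a \<Rightarrow> real" where
  "tilt p a x = (INF t\<in>{0..}. p (x + t *\<^sub>R a) - t * p a)"

lemma tilt_le:
  assumes "dominated_sublinear p" "t \<ge> 0"
  shows "tilt p a x \<le> p (x + t *\<^sub>R a) - t * p a"
  unfolding tilt_def
proof (rule cINF_lower)
  \<comment> \<open>Subadditivity at \<open>x + t *\<^sub>R a\<close> and \<open>- x\<close> gives a
    lower bound independent of \<open>t\<close>, so the infimum is genuine.\<close>
  have "- p (- x) \<le> p (x + t *\<^sub>R a) - t * p a" if "t \<ge> 0" for t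
    using dominated_sublinearD(1)[OF assms(1), of "x + t *\<^sub>R a" "- x"]
      dominated_sublinearD(5)[OF assms(1) that, of a] by simp
  then show "bdd_below ((\<lambda>t. p (x + t *\<^sub>R a) - t * p a) ` {0..})"
    by (intro bdd_belowI2[where m = "- p (- x)"]) auto
qed (use assms in auto)

lemma le_tilt:
  assumes "\<And>t. t \<ge> 0 \<Longrightarrow> m \<le> p (x + t *\<^sub>R a) - t * p a"
  shows "m \<le> tilt p a x"
  unfolding tilt_def by (rule cINF_greatest) (use assms in auto)

text \<open>Parameters \<open>t\<close> for \<open>x\<close> and \<open>s\<close> for
  \<open>y\<close> combine to \<open>t + s\<close> for \<open>x + y\<close>, and scaling
  \<open>x\<close> by \<open>c\<close> turns \<open>t\<close> into \<open>c * t\<close>;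
  \<open>t = 0\<close> gives the bound by the norm.\<close>

lemma dominated_sublinear_tilt:
  assumes p: "dominated_sublinear p"
  shows "dominated_sublinear (tilt p a)"
  unfolding dominated_sublinear_def
proof (intro conjI allI impI)
  fix x y
  have "tilt p a (x + y) - (p (y + s *\<^sub>R a) - s * p a) \<le> tilt p a x" if s: "s \<ge> 0" for s
  proof (rule le_tilt)
    fix t :: real assume t: "t \<ge> 0"
    have "tilt p a (x + y) \<le> p ((x + y) + (t + s) *\<^sub>R a) - (t + s) * p a"
      by (rule tilt_le[OF p]) (use s t in simp)
    moreover have "p ((x + y) + (t + s) *\<^sub>R a) \<le> p (x + t *\<^sub>R a) + p (y + s *\<^sub>R a)"
      using dominated_sublinearD(1)[OF p, of "x + t *\<^sub>R a" "y + s *\<^sub>R a"]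
      by (simp add: algebra_simps)
    ultimately show "tilt p a (x + y) - (p (y + s *\<^sub>R a) - s * p a)
        \<le> p (x + t *\<^sub>R a) - t * p a"
      by (simp add: algebra_simps)
  qed
  then have "tilt p a (x + y) - tilt p a x \<le> tilt p a y"
    by (intro le_tilt) (smt (verit))
  then show "tilt p a (x + y) \<le> tilt p a x + tilt p a y" by simp
next
  fix c :: real and x assume c: "c > 0"
  have "tilt p a (c *\<^sub>R x) / c \<le> tilt p a x"
  proof (rule le_tilt)
    fix t :: real assume t: "t \<ge> 0"
    have "tilt p a (c *\<^sub>R x) \<le> p (c *\<^sub>R x + (c * t) *\<^sub>R a) - c * t * p a"
      by (rule tilt_le[OF p]) (use c t in simp)
    also have "\<dots> = c * (p (x + t *\<^sub>R a) - t * p a)"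
      using dominated_sublinearD(5)[OF p, of c "x + t *\<^sub>R a"] c by (simp add: algebra_simps)
    finally show "tilt p a (c *\<^sub>R x) / c \<le> p (x + t *\<^sub>R a) - t * p a"
      using c by (simp add: field_simps)
  qed
  then show "tilt p a (c *\<^sub>R x) \<le> c * tilt p a x" using c by (simp add: field_simps)
next
  fix x show "tilt p a x \<le> norm x"
    using tilt_le[OF p, of 0 a x] dominated_sublinearD(2)[OF p, of x] by simp
qed

text \<open>Zorn's lemma for the reversed pointwise order: a nonempty chain is bounded below by its
  pointwise infimum, the empty chain by \<open>q\<close>.\<close>

lemma exists_minimal_dominated_sublinear:
  fixes q :: "'a::real_normed_vector \<Rightarrow> real"
  assumes q: "dominated_sublinear q"
  obtains p where "dominated_sublinear p" "p \<le> q"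
    "\<And>p'. dominated_sublinear p' \<Longrightarrow> p' \<le> p \<Longrightarrow> p' = p"
proof -
  define A where "A = {p. dominated_sublinear p \<and> p \<le> q}"
  let ?r = "relation_of (\<lambda>p p'. p' \<le> p) A"
  have "\<exists>m\<in>A. \<forall>p\<in>A. p \<le> m \<longrightarrow> p = m"
  proof (rule predicate_Zorn)
    show "partial_order_on A ?r"
      by (auto simp: partial_order_on_def preorder_on_def refl_on_def trans_def antisym_def
          relation_of_def intro: order_trans)
  next
    fix C assume C: "C \<in> Chains ?r"
    show "\<exists>u\<in>A. \<forall>p\<in>C. u \<le> p"
    proof (cases "C = {}")
      case True
      then show ?thesis using q by (auto simp: A_def)
    next
      case False
      have CA: "p \<in> A" if "p \<in> C" for p
        using C that by (auto simp: Chains_def relation_of_def)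
      have sub: "dominated_sublinear p" if "p \<in> C" for p using CA[OF that] by (simp add: A_def)
      have comp: "p \<le> p' \<or> p' \<le> p" if "p \<in> C" "p' \<in> C" for p p'
        using C that by (auto simp: Chains_def relation_of_def)
      define u where "u x = (INF p\<in>C. p x)" for x
      have u_le: "u x \<le> p x" if "p \<in> C" for p x
        unfolding u_def
      proof (rule cINF_lower[OF _ that])
        show "bdd_below ((\<lambda>p. p x) ` C)"
        proof (rule bdd_belowI2[where m = "- norm x"])
          fix p assume "p \<in> C"
          then show "- norm x \<le> p x"
            using dominated_sublinearD(2,3)[OF sub[OF \<open>p \<in> C\<close>]]
            by (metis minus_le_iff neg_le_iff_le norm_minus_cancel order_trans)
        qed
      qed
      have le_u: "m \<le> u x" if "\<And>p. p \<in> C \<Longrightarrow> m \<le> p x" for m x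
        unfolding u_def by (rule cINF_greatest) (use False that in auto)
      obtain p0 where p0: "p0 \<in> C" using False by blast
      have "dominated_sublinear u"
        unfolding dominated_sublinear_def
      proof (intro conjI allI impI)
        fix x y
        have "u (x + y) - p' y \<le> u x" if p': "p' \<in> C" for p'
        proof (rule le_u)
          fix p assume p: "p \<in> C"
          \<comment> \<open>Comparability is what makes the infimum subadditive: the smaller of
            \<open>p\<close> and \<open>p'\<close> can serve at both \<open>x\<close> and
            \<open>y\<close>.\<close>
          from comp[OF p p'] show "u (x + y) - p' y \<le> p x"
          proof
            assume "p \<le> p'"
            then have "p y \<le> p' y" by (simp add: le_fun_def)
            then show ?thesis
              using u_le[OF p, of "x + y"] dominated_sublinearD(1)[OF sub[OF p], of x y] by simp
          next
            assume "p' \<le> p"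
            then have "p' x \<le> p x" by (simp add: le_fun_def)
            then show ?thesis
              using u_le[OF p', of "x + y"] dominated_sublinearD(1)[OF sub[OF p'], of x y] by simp
          qed
        qed
        then have "u (x + y) - u x \<le> u y"
          by (intro le_u) (smt (verit))
        then show "u (x + y) \<le> u x + u y" by simp
      next
        fix c :: real and x assume c: "c > 0"
        have "u (c *\<^sub>R x) / c \<le> u x"
        proof (rule le_u)
          fix p assume p: "p \<in> C"
          show "u (c *\<^sub>R x) / c \<le> p x"
            using u_le[OF p, of "c *\<^sub>R x"] dominated_sublinearD(5)[OF sub[OF p], of c x] c
            by (simp add: field_simps)
        qed
        then show "u (c *\<^sub>R x) \<le> c * u x" using c by (simp add: field_simps)
      next
        fix x show "u x \<le> norm x"
          using u_le[OF p0, of x] dominated_sublinearD(2)[OF sub[OF p0], of x] by simp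
      qed
      moreover have "u \<le> q"
        using u_le[OF p0] CA[OF p0] by (auto simp: A_def le_fun_def intro: order_trans)
      ultimately show ?thesis
        using u_le by (auto simp: A_def le_fun_def)
    qed
  qed
  then obtain m where m: "m \<in> A" "\<And>p. p \<in> A \<Longrightarrow> p \<le> m \<Longrightarrow> p = m" by blast
  show ?thesis
  proof (rule that[of m])
    fix p' assume "dominated_sublinear p'" "p' \<le> m"
    then show "p' = m" using m by (auto simp: A_def intro: order_trans)
  qed (use m in \<open>auto simp: A_def\<close>)
qed

text \<open>Hahn-Banach by minimality: a minimal sublinear functional is linear, and starting the
  descent at \<open>tilt norm x0\<close> forces the value at \<open>x0\<close>.\<close>

lemma norming_real_functional:
  fixes x0 :: "'a::real_normed_vector"
  obtains f :: "'a \<Rightarrow> real" where "linear f" "\<And>x. \<bar>f x\<bar> \<le> norm x" "f x0 = norm x0"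
proof -
  have n: "dominated_sublinear (norm :: 'a \<Rightarrow> real)"
    by (auto simp: dominated_sublinear_def norm_triangle_ineq)
  obtain p where p: "dominated_sublinear p" and le: "p \<le> tilt norm x0"
    and min: "\<And>p'. dominated_sublinear p' \<Longrightarrow> p' \<le> p \<Longrightarrow> p' = p"
    using exists_minimal_dominated_sublinear[OF dominated_sublinear_tilt[OF n]] by metis
  note D = dominated_sublinearD[OF p]
  have tilt_eq: "tilt p a = p" for a
    by (rule min[OF dominated_sublinear_tilt[OF p]])
       (use tilt_le[OF p, of 0 a] in \<open>simp add: le_fun_def\<close>)
  \<comment> \<open>The case \<open>t = 1\<close> of \<open>tilt p y x = p x\<close> is
    superadditivity.\<close>
  have add: "p (x + y) = p x + p y" for x y
    using tilt_le[OF p, of 1 y x] D(1)[of x y] by (simp add: tilt_eq)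
  have minus: "p (- x) = - p x" for x
    using add[of x "- x"] D(4) by simp
  have "linear p"
  proof (rule linearI)
    show "p (c *\<^sub>R x) = c *\<^sub>R p x" for c x
      using D(5)[of c x] D(5)[of "- c" x] minus[of "c *\<^sub>R x"] by (cases "c \<ge> 0") auto
  qed (rule add)
  moreover have "\<bar>p x\<bar> \<le> norm x" for x
    using D(2)[of x] D(2)[of "- x"] minus[of x] by (simp add: abs_le_iff)
  moreover have "p x0 = norm x0"
  proof -
    have "p (- x0) \<le> tilt norm x0 (- x0)" using le by (simp add: le_fun_def)
    also have "\<dots> \<le> - norm x0" using tilt_le[OF n, of 1 x0 "- x0"] by simp
    finally show ?thesis using minus[of x0] D(2)[of x0] by simp
  qed
  ultimately show ?thesis using that by blast
qed

subsection \<open>Holomorphic functions with values in a complex Banach space\<close>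

lemma scaleC_zero_right [simp]: "a *\<^sub>C (0::'a::complex_banach) = 0"
  using scaleC_add_right[of a 0 "0::'a"] by simp

lemma scaleC_one [simp]: "1 *\<^sub>C (x::'a::complex_banach) = x"
  using scaleC_of_real[of 1 x] by simp

lemma scaleR_scaleC: "r *\<^sub>R (a *\<^sub>C x) = a *\<^sub>C (r *\<^sub>R (x::'a::complex_banach))"
  unfolding scaleC_of_real[symmetric] scaleC_scaleC by (simp add: mult.commute)

lemma bounded_linear_scaleC_right: "bounded_linear (\<lambda>x::'a::complex_banach. a *\<^sub>C x)"
  by (rule bounded_linear_intro[where K = "cmod a"])
     (simp_all add: scaleC_add_right scaleR_scaleC norm_scaleC)

lemma scaleC_scaleR_left: "(r *\<^sub>R a) *\<^sub>C x = r *\<^sub>R (a *\<^sub>C (x::'a::complex_banach))"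
  unfolding scaleC_of_real[symmetric] scaleC_scaleC by (simp add: scaleC_complex_def)

lemma bounded_linear_scaleC_left: "bounded_linear (\<lambda>a. a *\<^sub>C (x::'a::complex_banach))"
  by (rule bounded_linear_intro[where K = "norm x"])
     (simp_all add: scaleC_add_left scaleC_scaleR_left norm_scaleC)

text \<open>The factor 2 could be improved to 1, which is not worth the effort for an estimate with
  unspecified constants.\<close>

lemma almost_norming_complex_functional:
  fixes x0 :: "'a::complex_banach"
  obtains \<phi> :: "'a \<Rightarrow> complex" where "bounded_linear \<phi>" "\<And>a x. \<phi> (a *\<^sub>C x) = a * \<phi> x"
    "\<And>x. cmod (\<phi> x) \<le> 2 * norm x" "norm x0 \<le> cmod (\<phi> x0)"
proof -
  obtain f :: "'a \<Rightarrow> real" where f: "linear f" "\<And>x. \<bar>f x\<bar> \<le> norm x" "f x0 = norm x0"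
    using norming_real_functional by blast
  \<comment> \<open>The standard complexification: real part \<open>f\<close> and complex linearity
    force this imaginary part.\<close>
  define \<phi> where "\<phi> x = Complex (f x) (- f (\<i> *\<^sub>C x))" for x
  have cm: "cmod (\<phi> x) \<le> 2 * norm x" for x
    using cmod_le[of "\<phi> x"] f(2)[of x] f(2)[of "\<i> *\<^sub>C x"] by (simp add: \<phi>_def norm_scaleC)
  have add: "\<phi> (x + y) = \<phi> x + \<phi> y" for x y
    by (simp add: \<phi>_def scaleC_add_right linear_add[OF f(1)] complex_eq_iff)
  have scR: "\<phi> (r *\<^sub>R x) = r *\<^sub>R \<phi> x" for r x
    by (simp add: \<phi>_def scaleR_scaleC[symmetric] linear_scale[OF f(1)] complex_eq_iff)
  have bl: "bounded_linear \<phi>"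
    by (rule bounded_linear_intro[where K = 2]) (use add scR cm in \<open>simp_all add: mult.commute\<close>)
  have i: "\<phi> (\<i> *\<^sub>C x) = \<i> * \<phi> x" for x
    using scaleC_of_real[of "-1" x]
    by (simp add: \<phi>_def scaleC_scaleC complex_eq_iff linear_neg[OF f(1)])
  have sc: "\<phi> (a *\<^sub>C x) = a * \<phi> x" for a x
  proof -
    have "a *\<^sub>C x = Re a *\<^sub>R x + Im a *\<^sub>R (\<i> *\<^sub>C x)"
      unfolding scaleC_of_real[symmetric] scaleC_scaleC scaleC_add_left[symmetric]
      by (simp add: complex_eq[symmetric] mult.commute)
    then have "\<phi> (a *\<^sub>C x) = (Re a + \<i> * Im a) * \<phi> x"
      by (simp only: add scR i) (simp add: scaleR_conv_of_real algebra_simps)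
    then show ?thesis by (simp add: complex_eq[symmetric])
  qed
  have "norm x0 \<le> cmod (\<phi> x0)"
    using abs_Re_le_cmod[of "\<phi> x0"] f(3) by (simp add: \<phi>_def)
  then show ?thesis using that[of \<phi>] bl sc cm by blast
qed

text \<open>Cauchy's inequality bounds the second derivative on the half-size ball, and Taylor's
  formula does the rest. Discs of radius \<open>\<delta> / 4\<close> around points of that ball stay
  in \<open>ball z \<delta>\<close>, whence the constant
  \<open>2 * B / (\<delta> / 4)\<^sup>2\<close>.\<close>

lemma complex_second_order_bound:
  fixes g :: "complex \<Rightarrow> complex"
  assumes hol: "g holomorphic_on ball z \<delta>" and \<delta>: "\<delta> > 0" and h: "cmod h < \<delta> / 2"
    and bd: "\<And>w. w \<in> ball z \<delta> \<Longrightarrow> cmod (g w) \<le> B"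
  shows "cmod (g (z + h) - g z - h * deriv g z) \<le> 32 * B / \<delta>\<^sup>2 * (cmod h)\<^sup>2"
proof -
  let ?S = "ball z (\<delta> / 2)"
  have d2: "cmod ((deriv ^^ 2) g y) \<le> 32 * B / \<delta>\<^sup>2" if y: "y \<in> ?S" for y
  proof -
    have sub: "cball y (\<delta> / 4) \<subseteq> ball z \<delta>"
    proof
      fix x assume "x \<in> cball y (\<delta> / 4)"
      then show "x \<in> ball z \<delta>" using y \<delta> dist_triangle[of z x y] by simp
    qed
    have "cmod ((deriv ^^ 2) g y) \<le> fact 2 * B / (\<delta> / 4) ^ 2"
    proof (rule Cauchy_inequality)
      show "continuous_on (cball y (\<delta> / 4)) g"
        using holomorphic_on_imp_continuous_on[OF hol] sub continuous_on_subset by blast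
      show "g holomorphic_on ball y (\<delta> / 4)"
        using hol sub ball_subset_cball holomorphic_on_subset by blast
      show "cmod (g x) \<le> B" if "cmod (y - x) = \<delta> / 4" for x
        using bd[of x] sub that by (auto simp: dist_norm subset_iff)
    qed (use \<delta> in simp)
    then show ?thesis by (simp add: power_divide)
  qed
  have "cmod ((deriv ^^ 0) g (z + h) - (\<Sum>i\<le>1. (deriv ^^ i) g z * ((z + h) - z) ^ i / fact i))
          \<le> (32 * B / \<delta>\<^sup>2) * cmod ((z + h) - z) ^ Suc 1 / fact 1"
  proof (rule field_Taylor[where S = ?S])
    fix i x assume x: "x \<in> ?S"
    have "(deriv ^^ i) g holomorphic_on ball z \<delta>"
      by (rule holomorphic_higher_deriv[OF hol]) simp
    moreover have "x \<in> ball z \<delta>" using x \<delta> by simp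
    ultimately have "((deriv ^^ i) g has_field_derivative deriv ((deriv ^^ i) g) x) (at x)"
      using holomorphic_derivI open_ball by blast
    then show "((deriv ^^ i) g has_field_derivative (deriv ^^ Suc i) g x) (at x within ?S)"
      by (simp add: has_field_derivative_at_within)
  next
    show "cmod ((deriv ^^ Suc 1) g x) \<le> 32 * B / \<delta>\<^sup>2" if "x \<in> ?S" for x
      using d2[OF that] by (simp add: numeral_2_eq_2)
  qed (use \<delta> h in \<open>auto simp: dist_norm\<close>)
  then show ?thesis by (simp add: power2_eq_square mult.commute diff_diff_eq)
qed

text \<open>The functional is chosen for the remainder vector itself, so one scalar function
  suffices. The bound \<open>cmod (\<phi> x) \<le> 2 * norm x\<close> doubles the scalar
  constant.\<close>

lemma holomorphic_into_second_order_bound: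
  fixes u :: "complex \<Rightarrow> 'a::complex_banach"
  assumes der: "\<And>w. w \<in> ball z \<delta> \<Longrightarrow> (u has_derivative (\<lambda>h. h *\<^sub>C D w)) (at w)"
    and \<delta>: "\<delta> > 0" and h: "cmod h < \<delta> / 2"
    and bd: "\<And>w. w \<in> ball z \<delta> \<Longrightarrow> norm (u w) \<le> B"
  shows "norm (u (z + h) - u z - h *\<^sub>C D z) \<le> 64 * B / \<delta>\<^sup>2 * (cmod h)\<^sup>2"
proof -
  obtain \<phi> :: "'a \<Rightarrow> complex" where \<phi>: "bounded_linear \<phi>" "\<And>a x. \<phi> (a *\<^sub>C x) = a * \<phi> x"
    "\<And>x. cmod (\<phi> x) \<le> 2 * norm x"
    "norm (u (z + h) - u z - h *\<^sub>C D z) \<le> cmod (\<phi> (u (z + h) - u z - h *\<^sub>C D z))"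
    using almost_norming_complex_functional by blast
  let ?g = "\<lambda>w. \<phi> (u w)"
  have dg: "(?g has_field_derivative \<phi> (D w)) (at w)" if "w \<in> ball z \<delta>" for w
    using bounded_linear.has_derivative[OF \<phi>(1) der[OF that]]
    by (simp add: has_field_derivative_def \<phi>(2) mult_commute_abs)
  have hol: "?g holomorphic_on ball z \<delta>"
    unfolding holomorphic_on_open[OF open_ball] using dg by blast
  have "cmod (?g (z + h) - ?g z - h * deriv ?g z) \<le> 32 * (2 * B) / \<delta>\<^sup>2 * (cmod h)\<^sup>2"
    by (rule complex_second_order_bound[OF hol \<delta> h]) (use \<phi>(3) bd in \<open>smt (verit)\<close>)
  moreover have "deriv ?g z = \<phi> (D z)" using dg[of z] \<delta> by (simp add: DERIV_imp_deriv)
  ultimately show ?thesis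
    using \<phi>(4) by (simp add: linear_diff[OF bounded_linear.linear[OF \<phi>(1)]] \<phi>(2))
qed

subsection \<open>The Beta integral\<close>

text \<open>The factor \<open>s powr (1 / k)\<close> after the substitution
  \<open>s = 1 - v powr k\<close>, under which the weight \<open>(1 - s) powr (1 / k - 1) ds\<close>
  becomes \<open>k dv\<close> up to orientation.\<close>

definition radial_factor :: "real \<Rightarrow> real \<Rightarrow> real" where
  "radial_factor k v = (1 - v powr k) powr (1 / k)"

lemma one_minus_powr_bounds:
  assumes "k > 0" "0 \<le> v" "v < 1"
  shows "0 < 1 - v powr k" "1 - v powr k \<le> (1::real)"
  using powr_less_mono2[OF assms(1,2,3)] by simp_all

lemma radial_factor_props:
  assumes "k > 0" "0 \<le> v" "v < 1"
  shows "0 < radial_factor k v" "radial_factor k v \<le> 1"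
  using one_minus_powr_bounds[OF assms] assms(1) by (auto simp: radial_factor_def powr_le1)

lemma radial_factor_1 [simp]: "radial_factor k 1 = 0"
  by (simp add: radial_factor_def)

lemma continuous_on_radial_factor:
  assumes "k > 0"
  shows "continuous_on {0..1} (radial_factor k)"
  unfolding radial_factor_def
  by (intro continuous_on_powr' continuous_intros) (use assms powr_le1 in auto)

text \<open>With \<open>v = t powr (1 / k)\<close> this is
  \<open>Beta (1 / k) (1 + p / k) / k\<close>. The quotient of consecutive moments is what turns
  integration along a segment into the moment integral, term by term.\<close>

lemma has_integral_radial_factor_power:
  assumes k: "k > 0"
  shows "((\<lambda>v. radial_factor k v ^ p) has_integral
           Gamma (1 / k) / k * (gamma_moment k p / gamma_moment k (p + 1))) {0..1}"
proof -
  let ?f = "\<lambda>v. radial_factor k v ^ p"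
  let ?g = "\<lambda>t::real. t powr (1 / k)"
  have cf: "continuous_on {0..1} ?f"
    by (intro continuous_intros continuous_on_radial_factor k)
  have "((\<lambda>t. (1 / k * t powr (1 / k - 1)) *\<^sub>R ?f (?g t)) has_integral
          (integral {?g 0..?g 1} ?f - integral {?g 1..?g 0} ?f)) {0..1}"
  \<comment> \<open>The point 0 is exempted since \<open>t powr (1 / k)\<close> has no derivative
    there for \<open>k > 1\<close>.\<close>
  proof (rule has_integral_substitution_general[where s = "{0}" and c = 0 and d = 1])
    show "continuous_on {0..1} ?g"
      by (intro continuous_on_powr' continuous_intros) (use k in auto)
    show "(?g has_field_derivative 1 / k * t powr (1 / k - 1)) (at t within {0..1})"
      if "t \<in> {0..1} - {0}" for t
      using that by (intro DERIV_subset[OF has_real_derivative_powr]) auto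
  qed (use k cf in \<open>auto simp: powr_le1\<close>)
  then have "((\<lambda>t. (1 / k * t powr (1 / k - 1)) *\<^sub>R ?f (?g t)) has_integral
          integral {0..1} ?f) {0..1}"
    by simp
  moreover have "((\<lambda>t. (1 / k * t powr (1 / k - 1)) *\<^sub>R ?f (?g t)) has_integral
          1 / k * Beta (1 / k) (1 + real p / k)) {0..1}"
  \<comment> \<open>For \<open>p = 0\<close> the integrands differ at \<open>t = 1\<close>, where
    the power is 1 but \<open>0 powr 0 = 0\<close>.\<close>
  proof (rule has_integral_spike_finite[where S = "{1}"])
    show "((\<lambda>t. 1 / k * (t powr (1 / k - 1) * (1 - t) powr ((1 + real p / k) - 1)))
            has_integral 1 / k * Beta (1 / k) (1 + real p / k)) {0..1}"
      by (intro has_integral_mult_right has_integral_Beta_real) (use k in \<open>auto simp: add_pos_nonneg\<close>)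
    fix t :: real assume t: "t \<in> {0..1} - {1}"
    then have "?f (?g t) = (1 - t) powr (real p / k)"
      using k by (simp add: radial_factor_def powr_powr powr_power mult.commute)
    then show "(1 / k * t powr (1 / k - 1)) *\<^sub>R ?f (?g t) =
        1 / k * (t powr (1 / k - 1) * (1 - t) powr ((1 + real p / k) - 1))"
      by simp
  qed simp
  ultimately have "integral {0..1} ?f = 1 / k * Beta (1 / k) (1 + real p / k)"
    by (rule has_integral_unique)
  moreover have "1 / k * Beta (1 / k) (1 + real p / k) =
      Gamma (1 / k) / k * (gamma_moment k p / gamma_moment k (p + 1))"
    by (simp add: Beta_def gamma_moment_def add_divide_distrib add_ac)
  ultimately show ?thesis
    using integrable_integral[OF integrable_continuous_real[OF cf]] by simp
qed

section \<open>Values of a function along the segment from a point to the vertex\<close>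

text \<open>Multiplication of \<open>z\<close> by the radial factor, in the chart \<open>w = log z\<close>; meaningful only for
  \<open>v < 1\<close>, as \<open>ln 0 = 0\<close>.\<close>

definition log_dilation :: "real \<Rightarrow> real \<Rightarrow> complex" where
  "log_dilation k v = of_real (ln (1 - v powr k) / k)"

lemma exp_log_dilation:
  assumes "k > 0" "0 \<le> v" "v < 1"
  shows "exp (log_dilation k v) = of_real (radial_factor k v)"
  using one_minus_powr_bounds[OF assms]
  by (simp add: log_dilation_def radial_factor_def powr_def flip: exp_of_real)

lemma add_log_dilation_mem_bounded_sector:
  assumes "k > 0" "0 \<le> v" "v < 1" "w \<in> bounded_sector d \<theta> r"
  shows "w + log_dilation k v \<in> bounded_sector d \<theta> r"
proof -
  have "ln (1 - v powr k) / k \<le> 0"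
    using one_minus_powr_bounds[OF assms(1-3)] assms(1) by (simp add: divide_nonpos_pos)
  then have "exp (Re (w + log_dilation k v)) \<le> exp (Re w)" by (simp add: log_dilation_def)
  moreover have "Im (w + log_dilation k v) = Im w" by (simp add: log_dilation_def)
  ultimately show ?thesis
    using assms(4) unfolding bounded_sector_def mem_Collect_eq by (metis order.strict_trans1)
qed

text \<open>Here \<open>v = 0\<close> gives \<open>u w\<close>, and \<open>v = 1\<close> is the
  vertex, which has no logarithmic coordinate. The limit \<open>a\<close> of \<open>u\<close> is put
  in there, since \<open>log_dilation k 1 = 0\<close> would give back \<open>u w\<close>.\<close>

definition ray_values :: "real \<Rightarrow> (complex \<Rightarrow> 'a) \<Rightarrow> 'a \<Rightarrow> complex \<Rightarrow> real \<Rightarrow> 'a" where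
  "ray_values k u a w v = (if v = 1 then a else u (w + log_dilation k v))"

text \<open>The critical point is \<open>v = 1\<close>, where \<open>bd\<close> bounds the distance
  to \<open>a\<close> by a multiple of \<open>radial_factor k v\<close>, which tends to 0.\<close>

lemma continuous_on_ray_values:
  fixes u :: "complex \<Rightarrow> 'a::real_normed_vector"
  assumes k: "k > 0" and u: "continuous_on (bounded_sector d \<theta> r) u"
    and w: "w \<in> bounded_sector d \<theta> r"
    and bd: "\<And>w. w \<in> bounded_sector d \<theta> r \<Longrightarrow> norm (u w - a) \<le> K * cmod (exp w)"
  shows "continuous_on {0..1} (ray_values k u a w)"
  unfolding continuous_on_eq_continuous_within
proof
  fix x :: real assume x: "x \<in> {0..1}"
  show "continuous (at x within {0..1}) (ray_values k u a w)"
  proof (cases "x = 1")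
    case False
    have "continuous_on {0..<1} (\<lambda>v. u (w + log_dilation k v))"
      unfolding log_dilation_def
    proof (rule continuous_on_compose2[OF u])
      show "continuous_on {0..<1} (\<lambda>v. w + complex_of_real (ln (1 - v powr k) / k))"
        by (intro continuous_intros continuous_on_powr')
           (use k one_minus_powr_bounds[OF k] in force)+
    qed (use add_log_dilation_mem_bounded_sector[OF k _ _ w] in \<open>auto simp: log_dilation_def\<close>)
    then have "continuous_on {0..<1} (ray_values k u a w)"
      by (rule continuous_on_eq) (simp add: ray_values_def)
    then have "continuous (at x within {0..<1}) (ray_values k u a w)"
      using x False by (simp add: continuous_on_eq_continuous_within)
    moreover have "at x within {0..<1} = at x within {0..1}"
      by (rule at_within_nhd[of x "{..<1}"]) (use x False in auto)
    ultimately show ?thesis by simp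
  next
    case True
    have "(ray_values k u a w \<longlongrightarrow> a) (at 1 within {0..1})"
    proof (rule LIM_zero_cancel, rule Lim_null_comparison)
      have "norm (ray_values k u a w v - a) \<le> K * cmod (exp w) * radial_factor k v"
        if "v \<in> {0..1}" "v \<noteq> 1" for v
        using that bd[OF add_log_dilation_mem_bounded_sector[OF k _ _ w], of v]
          radial_factor_props[OF k, of v]
        by (simp add: ray_values_def exp_add exp_log_dilation[OF k] norm_mult del: norm_exp_eq_Re)
      then show "\<forall>\<^sub>F v in at 1 within {0..1}. norm (ray_values k u a w v - a)
          \<le> K * cmod (exp w) * radial_factor k v"
        by (auto simp: eventually_at_filter)
      have "(radial_factor k \<longlongrightarrow> radial_factor k 1) (at 1 within {0..1})"
        using bspec[OF continuous_on_radial_factor[OF k, unfolded continuous_on_def], of 1] by simp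
      from tendsto_mult_left[OF this, of "K * cmod (exp w)"]
      show "((\<lambda>v. K * cmod (exp w) * radial_factor k v) \<longlongrightarrow> 0) (at 1 within {0..1})"
        by simp
    qed
    then show ?thesis using True by (simp add: continuous_within ray_values_def)
  qed
qed

lemma bounded_bilinear_scaleC:
  "bounded_bilinear (\<lambda>a (x::'a::complex_banach). a *\<^sub>C x)"
  by (rule bounded_bilinear.intro)
     (auto simp: scaleC_add_left scaleC_add_right scaleC_scaleR_left scaleR_scaleC norm_scaleC
       intro!: exI[of _ 1])

text \<open>In the logarithmic chart the sector is a half-strip, an intersection of half-planes;
  openness and convexity are then immediate.\<close>

lemma bounded_sector_eq:
  assumes "r > 0"
  shows "bounded_sector d \<theta> r =
     {w. Im w > d - \<theta> / 2} \<inter> {w. Im w < d + \<theta> / 2} \<inter> {w. Re w < ln r}"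
proof -
  have "exp (Re w) < r \<longleftrightarrow> Re w < ln r" for w
    using assms by (metis exp_less_cancel_iff exp_ln)
  moreover have "\<bar>Im w - d\<bar> < \<theta> / 2 \<longleftrightarrow> Im w > d - \<theta> / 2 \<and> Im w < d + \<theta> / 2" for w
    by linarith
  ultimately show ?thesis unfolding bounded_sector_def by blast
qed

lemma open_bounded_sector: "r > 0 \<Longrightarrow> open (bounded_sector d \<theta> r)"
  unfolding bounded_sector_eq
  by (intro open_Int open_halfspace_Im_gt open_halfspace_Im_lt open_halfspace_Re_lt)

lemma convex_bounded_sector: "r > 0 \<Longrightarrow> convex (bounded_sector d \<theta> r)"
  unfolding bounded_sector_eq
  by (intro convex_Int convex_halfspace_Im_gt convex_halfspace_Im_lt convex_halfspace_Re_lt)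

lemma sectorial_region_bounded_sector:
  assumes "r > 0" "\<theta> > 0"
  shows "sectorial_region d \<theta> (bounded_sector d \<theta> r)"
  unfolding sectorial_region_def
proof (intro conjI allI impI)
  show "\<exists>r'>0. bounded_sector d \<theta> r \<subseteq> bounded_sector d \<theta> r'" using assms by blast
  show "\<exists>r'>0. bounded_sector d \<theta>' r' \<subseteq> bounded_sector d \<theta> r" if "0 < \<theta>' \<and> \<theta>' < \<theta>" for \<theta>'
    using that assms by (intro exI[of _ r]) (auto simp: bounded_sector_def)
qed (use assms open_bounded_sector convex_connected[OF convex_bounded_sector] in auto)

section \<open>The integral operator inverting the moment derivative\<close>

text \<open>The substitution \<open>s = 1 - v powr k\<close> in the formula for \<open>F\<close> makes the integrand continuous on
  \<open>[0, 1]\<close>.\<close>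

definition beta_integral ::
  "real \<Rightarrow> (complex \<Rightarrow> 'a::complex_banach) \<Rightarrow> 'a \<Rightarrow> complex \<Rightarrow> 'a" where
  "beta_integral k u a w =
     (of_real (k / Gamma (1 / k)) * exp w) *\<^sub>C integral {0..1} (ray_values k u a w)"

text \<open>Differentiation under the integral sign: the second-order remainder of the integrand is
  at most \<open>C * (cmod h)\<^sup>2\<close> uniformly in \<open>v\<close>, so integrating it gives
  the derivative of the integral. The factor \<open>exp w\<close> enters by the product
  rule.\<close>

lemma holomorphic_into_beta_integral:
  fixes u :: "complex \<Rightarrow> 'a::complex_banach"
  assumes k: "k > 0" and r: "r > 0"
    and hol: "holomorphic_into u (bounded_sector d \<theta> r)"
    and B: "\<And>w. w \<in> bounded_sector d \<theta> r \<Longrightarrow> norm (u w) \<le> B"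
    and bd: "\<And>w. w \<in> bounded_sector d \<theta> r \<Longrightarrow> norm (u w - a) \<le> K * cmod (exp w)"
  shows "holomorphic_into (beta_integral k u a) (bounded_sector d \<theta> r)"
  unfolding holomorphic_into_def
proof
  let ?S = "bounded_sector d \<theta> r"
  fix w assume w: "w \<in> ?S"
  obtain D where D: "\<And>w. w \<in> ?S \<Longrightarrow> (u has_derivative (\<lambda>h. h *\<^sub>C D w)) (at w)"
    using hol unfolding holomorphic_into_def by metis
  have cu: "continuous_on ?S u"
    using D has_derivative_continuous continuous_at_imp_continuous_on by blast
  have cray: "continuous_on {0..1} (ray_values k u a x)" if "x \<in> ?S" for x
    by (rule continuous_on_ray_values[OF k cu that bd])
  obtain \<delta> where \<delta>: "\<delta> > 0" and sub: "ball w \<delta> \<subseteq> ?S"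
    using open_bounded_sector[OF r] w open_contains_ball by blast
  have ballS: "w + h \<in> ?S" if "cmod h < \<delta>" for h
    using sub that by (auto simp: dist_norm)
  \<comment> \<open>At \<open>v = 1\<close> the integrand is the constant \<open>a\<close>, so its
    derivative in \<open>w\<close> is 0.\<close>
  define D' where "D' v = (if v = 1 then 0 else D (w + log_dilation k v))" for v
  define C where "C = 64 * B / \<delta>\<^sup>2"
  have "B \<ge> 0" using B[OF w] norm_ge_zero order_trans by blast
  then have C0: "C \<ge> 0" by (simp add: C_def)
  have second_order: "norm (ray_values k u a (w + h) v - ray_values k u a w v - h *\<^sub>C D' v)
      \<le> C * (cmod h)\<^sup>2" if h: "cmod h < \<delta> / 2" and v: "v \<in> {0..1}" for h v
  proof (cases "v = 1")
    case False
    let ?l = "log_dilation k v"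
    \<comment> \<open>One radius works for every \<open>v\<close>: translation by \<open>?l\<close>
      maps the sector into itself and carries the ball around \<open>w\<close> to the ball around
      \<open>w + ?l\<close>.\<close>
    have mem: "x \<in> ?S" if "x \<in> ball (w + ?l) \<delta>" for x
    proof -
      have "x - ?l \<in> ?S"
        using that sub by (auto simp: dist_norm algebra_simps)
      from add_log_dilation_mem_bounded_sector[OF k _ _ this, of v] show ?thesis
        using v False by simp
    qed
    have "norm (u ((w + ?l) + h) - u (w + ?l) - h *\<^sub>C D (w + ?l)) \<le> 64 * B / \<delta>\<^sup>2 * (cmod h)\<^sup>2"
      by (rule holomorphic_into_second_order_bound[OF D[OF mem] \<delta> h B[OF mem]])
    then show ?thesis
      using False by (simp add: ray_values_def D'_def C_def add_ac)
  qed (use C0 in \<open>simp add: ray_values_def D'_def\<close>)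
  define q where "q h v = inverse h *\<^sub>C (ray_values k u a (w + h) v - ray_values k u a w v)" for h v
  have q_bound: "norm (q h v - D' v) \<le> C * cmod h"
    if h: "cmod h < \<delta> / 2" "h \<noteq> 0" and v: "v \<in> {0..1}" for h v
  proof -
    have "q h v - D' v = inverse h *\<^sub>C
        (ray_values k u a (w + h) v - ray_values k u a w v - h *\<^sub>C D' v)"
      unfolding q_def linear_diff[OF bounded_linear.linear[OF bounded_linear_scaleC_right]]
      using h by (simp add: scaleC_scaleC)
    then have "norm (q h v - D' v) \<le> inverse (cmod h) * (C * (cmod h)\<^sup>2)"
      using second_order[OF h(1) v] by (simp add: norm_scaleC norm_inverse mult_left_mono)
    then show ?thesis using h by (simp add: power2_eq_square field_simps)
  qed
  \<comment> \<open>Integrability of \<open>D'\<close> comes from its being a uniform limit of the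
    continuous difference quotients \<open>q h\<close>.\<close>
  have cD': "continuous_on {0..1} D'"
  proof (rule uniform_limit_theorem[where F = "at 0" and f = q])
    show "\<forall>\<^sub>F h in at 0. continuous_on {0..1} (q h)"
      unfolding eventually_at
    proof (intro exI[of _ \<delta>] conjI ballI impI)
      fix h :: complex assume "h \<noteq> 0 \<and> dist h 0 < \<delta>"
      then show "continuous_on {0..1} (q h)"
        unfolding q_def
        by (intro bounded_linear.continuous_on[OF bounded_linear_scaleC_right]
              continuous_on_diff cray w ballS) simp
    qed (rule \<delta>)
    show "uniform_limit {0..1} q D' (at 0)"
    proof (rule uniform_limitI)
      fix e :: real assume e: "e > 0"
      show "\<forall>\<^sub>F h in at 0. \<forall>v\<in>{0..1}. dist (q h v) (D' v) < e"
        unfolding eventually_at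
      proof (intro exI[of _ "min (\<delta> / 2) (e / (C + 1))"] conjI ballI impI)
        fix h :: complex and v :: real
        assume h: "h \<noteq> 0 \<and> dist h 0 < min (\<delta> / 2) (e / (C + 1))" and v: "v \<in> {0..1}"
        have "dist (q h v) (D' v) \<le> C * cmod h"
          using q_bound[of h v] h v by (simp add: dist_norm)
        also have "\<dots> \<le> (C + 1) * cmod h" by (simp add: algebra_simps)
        also have "\<dots> < e" using h C0 by (simp add: field_simps)
        finally show "dist (q h v) (D' v) < e" .
      qed (use \<delta> e C0 in simp)
    qed
  qed simp
  define J where "J x = integral {0..1} (ray_values k u a x)" for x
  have int_ray: "(ray_values k u a x has_integral J x) {0..1}" if "x \<in> ?S" for x
    unfolding J_def using cray[OF that] integrable_continuous_real integrable_integral by blast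
  define E where "E = integral {0..1} D'"
  have int_D': "(D' has_integral E) {0..1}"
    unfolding E_def using cD' integrable_continuous_real integrable_integral by blast
  have J_bound: "norm (J (w + h) - J w - h *\<^sub>C E) \<le> C * (cmod h)\<^sup>2" if h: "cmod h < \<delta> / 2" for h
  proof -
    have "((\<lambda>v. ray_values k u a (w + h) v - ray_values k u a w v - h *\<^sub>C D' v)
        has_integral (J (w + h) - J w - h *\<^sub>C E)) {0..1}"
      by (intro has_integral_diff int_ray w ballS
            has_integral_linear[OF int_D' bounded_linear_scaleC_right, unfolded o_def])
         (use h \<delta> in simp)
    from has_integral_bound[OF _ this[folded box_real(2)], of "C * (cmod h)\<^sup>2"]
    show ?thesis using second_order[OF h] C0 by simp
  qed
  have "(J has_derivative (\<lambda>h. h *\<^sub>C E)) (at w)"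
    unfolding has_derivative_at
  proof (intro conjI bounded_linear_scaleC_left, rule Lim_null_comparison)
    show "\<forall>\<^sub>F h in at 0. norm (norm (J (w + h) - J w - h *\<^sub>C E) / norm h) \<le> C * norm h"
      unfolding eventually_at
      using J_bound \<delta> by (intro exI[of _ "\<delta> / 2"]) (auto simp: field_simps power2_eq_square)
    show "((\<lambda>h::complex. C * norm h) \<longlongrightarrow> 0) (at 0)"
      by (intro tendsto_eq_intros) auto
  qed
  moreover have "((\<lambda>w. c * exp w) has_derivative (\<lambda>h. h * (c * exp w))) (at w)" for c
    by (auto intro!: derivative_eq_intros)
  ultimately have "((\<lambda>w. (of_real (k / Gamma (1 / k)) * exp w) *\<^sub>C J w) has_derivative
      (\<lambda>h. (of_real (k / Gamma (1 / k)) * exp w) *\<^sub>C (h *\<^sub>C E)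
           + (h * (of_real (k / Gamma (1 / k)) * exp w)) *\<^sub>C J w)) (at w)"
    by (intro bounded_bilinear.FDERIV[OF bounded_bilinear_scaleC])
  moreover have "(\<lambda>h. (of_real (k / Gamma (1 / k)) * exp w) *\<^sub>C (h *\<^sub>C E)
           + (h * (of_real (k / Gamma (1 / k)) * exp w)) *\<^sub>C J w) =
      (\<lambda>h. h *\<^sub>C ((of_real (k / Gamma (1 / k)) * exp w) *\<^sub>C (E + J w)))"
    by (simp add: scaleC_scaleC scaleC_add_right mult_ac)
  ultimately show "\<exists>D. (beta_integral k u a has_derivative (\<lambda>h. h *\<^sub>C D)) (at w)"
    unfolding beta_integral_def J_def by auto
qed

text \<open>The Taylor polynomial of \<open>u\<close> integrates exactly to that of the moment
  integral, and only the remainder is estimated. The outer factor \<open>exp w\<close> raises the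
  order from \<open>n\<close> to \<open>Suc n\<close>; for \<open>n = 0\<close> the premise is a
  plain bound on \<open>u\<close>.\<close>

lemma beta_integral_remainder_bound:
  fixes u :: "complex \<Rightarrow> 'a::complex_banach" and f :: "'a fps"
  assumes k: "k > 0" and w: "w \<in> bounded_sector d \<theta> r"
    and u: "continuous_on (bounded_sector d \<theta> r) u"
    and bd: "\<And>w. w \<in> bounded_sector d \<theta> r \<Longrightarrow> norm (u w - fps_nth f 0) \<le> K * cmod (exp w)"
    and L: "L \<ge> 0"
    and rem: "\<And>w. w \<in> bounded_sector d \<theta> r \<Longrightarrow>
      norm (u w - (\<Sum>p<n. exp w ^ p *\<^sub>C fps_nth f p)) \<le> L * cmod (exp w) ^ n"
  shows "norm (beta_integral k u (fps_nth f 0) w -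
            (\<Sum>p<Suc n. exp w ^ p *\<^sub>C fps_nth (moment_integral (gamma_moment k) f) p))
         \<le> k / Gamma (1 / k) * L * cmod (exp w) ^ Suc n"
proof -
  let ?a = "fps_nth f" and ?c = "k / Gamma (1 / k)"
  let ?ratio = "\<lambda>p. gamma_moment k p / gamma_moment k (p + 1)"
  define J where "J = integral {0..1} (ray_values k u (?a 0) w)"
  \<comment> \<open>The integral of the Taylor polynomial along the segment; \<open>1 / ?c\<close>
    is the factor \<open>Gamma (1 / k) / k\<close> of the Beta integral.\<close>
  let ?T = "\<Sum>p<n. (1 / ?c * ?ratio p) *\<^sub>R (exp w ^ p *\<^sub>C ?a p)"
  have c: "?c > 0" using k by simp
  have "((\<lambda>v. \<Sum>p<n. radial_factor k v ^ p *\<^sub>R (exp w ^ p *\<^sub>C ?a p)) has_integral ?T) {0..1}"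
    by (intro has_integral_sum has_integral_scaleR_left)
       (use has_integral_radial_factor_power[OF k] in auto)
  then have int: "((\<lambda>v. ray_values k u (?a 0) w v
        - (\<Sum>p<n. radial_factor k v ^ p *\<^sub>R (exp w ^ p *\<^sub>C ?a p))) has_integral (J - ?T)) {0..1}"
    unfolding J_def
    by (intro has_integral_diff integrable_integral integrable_continuous_real
          continuous_on_ray_values[OF k u w bd])
  have "norm (J - ?T) \<le> L * cmod (exp w) ^ n * Henstock_Kurzweil_Integration.content (cbox 0 (1::real))"
  proof (rule has_integral_bound_spike_finite[OF _ _ int[folded box_real(2)], of _ "{1}"])
    show "0 \<le> L * cmod (exp w) ^ n" using L by simp
    fix v :: real assume "v \<in> cbox 0 1 - {1}"
    then have v: "0 \<le> v" "v < 1" by auto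
    have e: "exp (w + log_dilation k v) = of_real (radial_factor k v) * exp w"
      by (simp add: exp_add exp_log_dilation[OF k v])
    have "norm (u (w + log_dilation k v) -
        (\<Sum>p<n. (of_real (radial_factor k v) * exp w) ^ p *\<^sub>C ?a p))
      \<le> L * (radial_factor k v * cmod (exp w)) ^ n"
      using rem[OF add_log_dilation_mem_bounded_sector[OF k v w]] radial_factor_props[OF k v]
      unfolding e norm_mult by simp
    also have "\<dots> \<le> L * cmod (exp w) ^ n"
      using radial_factor_props[OF k v] L
      by (intro mult_left_mono power_mono mult_left_le_one_le) auto
    finally show "norm (ray_values k u (?a 0) w v
        - (\<Sum>p<n. radial_factor k v ^ p *\<^sub>R (exp w ^ p *\<^sub>C ?a p))) \<le> L * cmod (exp w) ^ n"
      using v by (simp add: ray_values_def power_mult_distrib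
          flip: scaleC_of_real scaleC_scaleC)
  qed simp
  then have J: "norm (J - ?T) \<le> L * cmod (exp w) ^ n" by simp
  have "(of_real ?c * exp w) *\<^sub>C ?T =
      (\<Sum>p<n. exp w ^ Suc p *\<^sub>C (?ratio p *\<^sub>R ?a p))"
    unfolding linear_sum[OF bounded_linear.linear[OF bounded_linear_scaleC_right]]
  proof (rule sum.cong[OF refl])
    fix p
    have "(of_real c * exp w) * (of_real (1 / c * \<rho>) * exp w ^ p) = exp w ^ Suc p * of_real \<rho>"
      if "c > 0" for c \<rho> :: real
      using that by simp
    from this[OF c] show "(of_real ?c * exp w) *\<^sub>C ((1 / ?c * ?ratio p) *\<^sub>R (exp w ^ p *\<^sub>C ?a p)) =
        exp w ^ Suc p *\<^sub>C (?ratio p *\<^sub>R ?a p)"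
      unfolding scaleC_of_real[symmetric] scaleC_scaleC by (rule arg_cong)
  qed
  \<comment> \<open>The constant coefficient of the moment integral is 0, so only the shifted terms
    remain.\<close>
  then have "beta_integral k u (?a 0) w -
      (\<Sum>p<Suc n. exp w ^ p *\<^sub>C fps_nth (moment_integral (gamma_moment k) f) p) =
      (of_real ?c * exp w) *\<^sub>C (J - ?T)"
    unfolding linear_diff[OF bounded_linear.linear[OF bounded_linear_scaleC_right]]
      sum.lessThan_Suc_shift
    by (simp add: beta_integral_def J_def moment_integral_def)
  then have "norm (beta_integral k u (?a 0) w -
      (\<Sum>p<Suc n. exp w ^ p *\<^sub>C fps_nth (moment_integral (gamma_moment k) f) p)) =
      ?c * cmod (exp w) * norm (J - ?T)"
    using c by (simp only: norm_scaleC norm_mult norm_of_real abs_of_pos)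
  also have "\<dots> \<le> ?c * cmod (exp w) * (L * cmod (exp w) ^ n)"
    by (rule mult_left_mono[OF J mult_nonneg_nonneg[OF less_imp_le[OF c] norm_ge_zero]])
  finally show ?thesis by (simp add: mult_ac)
qed

section \<open>Summability of the moment integral\<close>

lemma moment_deriv_moment_integral:
  fixes f :: "'a::real_vector fps"
  assumes "\<And>p. m p \<noteq> 0"
  shows "moment_deriv m (moment_integral m f) = f"
  using assms by (simp add: fps_eq_iff moment_deriv_def moment_integral_def)

lemma gamma_moment_pos: "k > 0 \<Longrightarrow> gamma_moment k p > 0"
  by (simp add: gamma_moment_def add_pos_nonneg)

lemma msummable_moment_integral:
  fixes uhat :: "'f::complex_banach fps"
  assumes k: "k > 0" and M: "mono M" "M 0 = 1" and sum: "is_msum M d uhat G u"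
  shows "msummable M d (moment_integral (gamma_moment k) uhat)"
proof -
  obtain \<theta> where \<theta>: "ereal \<theta> > ereal pi * growth_index M" "sectorial_region d \<theta> G"
    "holomorphic_into u G" "asymptotic_expansion M d \<theta> G u uhat"
    using sum by (auto simp: is_msum_def)
  have "\<theta> > 0" using \<theta>(2) by (simp add: sectorial_region_def)
  \<comment> \<open>The expansion is controlled only on sectors of opening below
    \<open>\<theta>\<close>, so an opening strictly between the summability threshold and
    \<open>\<theta>\<close> is chosen; the maximum with \<open>\<theta> / 2\<close> makes it
    positive.\<close>
  obtain x where x: "ereal pi * growth_index M < ereal x" "ereal x < ereal \<theta>"
    using ereal_dense2[OF \<theta>(1)] by blast
  define \<theta>1 where "\<theta>1 = max x (\<theta> / 2)"
  have \<theta>1: "ereal pi * growth_index M < ereal \<theta>1" "0 < \<theta>1" "\<theta>1 < \<theta>"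
    using order.strict_trans2[OF x(1), of "ereal \<theta>1"] x(2) \<open>\<theta> > 0\<close> by (auto simp: \<theta>1_def)
  obtain r where r: "r > 0" and sub: "bounded_sector d \<theta>1 r \<subseteq> G"
    using \<theta>(2) \<theta>1 unfolding sectorial_region_def by blast
  let ?S = "bounded_sector d \<theta>1 r" and ?a = "fps_nth uhat"
  obtain C A where C: "C > 0" and A: "A > 0" and asym: "\<And>N w. N \<ge> 1 \<Longrightarrow> w \<in> ?S \<Longrightarrow>
      norm (u w - (\<Sum>p<N. exp w ^ p *\<^sub>C ?a p)) \<le> C * A ^ N * M N * cmod (exp w) ^ N"
    using \<theta>(4)[unfolded asymptotic_expansion_def, rule_format, of \<theta>1 r] \<theta>1 r sub by blast
  have M1: "M n \<ge> 1" for n using M monoD[OF M(1), of 0 n] by simp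
  define K where "K = C * A * M 1"
  have K: "K > 0" using C A M1[of 1] by (simp add: K_def)
  have bd: "norm (u w - ?a 0) \<le> K * cmod (exp w)" if "w \<in> ?S" for w
    using asym[OF _ that, of 1] by (simp add: K_def del: norm_exp_eq_Re)
  define B where "B = K * r + norm (?a 0)"
  have B: "norm (u w) \<le> B" if w: "w \<in> ?S" for w
  proof -
    have "norm (u w) \<le> K * cmod (exp w) + norm (?a 0)"
      using bd[OF w] norm_triangle_sub[of "u w" "?a 0"] by simp
    also have "K * cmod (exp w) \<le> K * r"
      using w K by (simp add: bounded_sector_def)
    finally show ?thesis by (simp add: B_def)
  qed
  have hol: "holomorphic_into u ?S" using \<theta>(3) sub by (auto simp: holomorphic_into_def)
  then have cu: "continuous_on ?S u"
    unfolding holomorphic_into_def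
    using has_derivative_continuous continuous_at_imp_continuous_on by blast
  let ?F = "beta_integral k u (?a 0)" and ?c = "k / Gamma (1 / k)"
  have c: "?c > 0" using k by simp
  \<comment> \<open>\<open>max C B\<close> covers \<open>n = 0\<close>, where the expansion of
    \<open>u\<close> gives no estimate and the bound \<open>B\<close> takes over;
    \<open>A' \<ge> 1\<close> makes the powers of \<open>A'\<close> nondecreasing in the
    exponent.\<close>
  define C' where "C' = ?c * max C B"
  define A' where "A' = max A 1"
  have C': "C' > 0" unfolding C'_def using c C by (intro mult_pos_pos) auto
  have A': "A' \<ge> 1" by (simp add: A'_def)
  have est: "norm (?F w - (\<Sum>p<N. exp w ^ p *\<^sub>C fps_nth (moment_integral (gamma_moment k) uhat) p))
      \<le> C' * A' ^ N * M N * cmod (exp w) ^ N" if w: "w \<in> ?S" and N: "N \<ge> 1" for w N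
  proof -
    obtain n where n: "N = Suc n" using N by (cases N) auto
    define L where "L = max C B * A' ^ n * M n"
    have nn: "0 \<le> A' ^ n" "0 \<le> M n" "0 \<le> max C B" using A' M1[of n] C by auto
    have L: "L \<ge> 0" unfolding L_def using nn by simp
    have "norm (?F w -
        (\<Sum>p<Suc n. exp w ^ p *\<^sub>C fps_nth (moment_integral (gamma_moment k) uhat) p))
      \<le> ?c * L * cmod (exp w) ^ Suc n"
    proof (rule beta_integral_remainder_bound[OF k w cu bd L])
      fix z assume z: "z \<in> ?S"
      show "norm (u z - (\<Sum>p<n. exp z ^ p *\<^sub>C ?a p)) \<le> L * cmod (exp z) ^ n"
      proof (cases "n = 0")
        case True
        then show ?thesis using B[OF z] M(2) by (simp add: L_def)
      next
        case False
        have "C * A ^ n * M n \<le> L"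
          unfolding L_def using nn A C M1[of n]
          by (intro mult_mono power_mono) (auto simp: A'_def)
        then show ?thesis
          using asym[OF _ z, of n] False
          by (smt (verit) less_one mult_right_mono norm_ge_zero not_less zero_le_power)
      qed
    qed
    \<comment> \<open>\<open>A' ^ n * M n\<close> is nondecreasing in \<open>n\<close>, which
      absorbs the shift from order \<open>n\<close> of \<open>u\<close> to order
      \<open>Suc n\<close> of the integral.\<close>
    also have "?c * L \<le> C' * A' ^ Suc n * M (Suc n)"
    proof -
      have "A' ^ n * M n \<le> A' ^ Suc n * M (Suc n)"
        using nn A' M(1) by (intro mult_mono power_increasing monoD[OF M(1)]) auto
      then have "C' * (A' ^ n * M n) \<le> C' * (A' ^ Suc n * M (Suc n))"
        using C' by (intro mult_left_mono) auto
      then show ?thesis by (simp add: L_def C'_def mult_ac)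
    qed
    finally show ?thesis unfolding n by (simp add: mult_right_mono)
  qed
  have "is_msum M d (moment_integral (gamma_moment k) uhat) ?S ?F"
    unfolding is_msum_def
  proof (intro exI[of _ \<theta>1] conjI \<theta>1(1) sectorial_region_bounded_sector r \<theta>1(2)
      holomorphic_into_beta_integral[OF k r hol B bd])
    show "asymptotic_expansion M d \<theta>1 ?S ?F (moment_integral (gamma_moment k) uhat)"
      unfolding asymptotic_expansion_def
    proof (intro allI impI, rule exI[of _ C'], intro conjI C', rule exI[of _ A'],
        intro conjI allI impI ballI)
      show "A' > 0" using A' by simp
    qed (use est in blast)
  qed
  then show ?thesis unfolding msummable_def by blast
qed

theorem proposition5:
  fixes k d :: real
    and M :: "nat \<Rightarrow> real"
    and uhat :: "'f::complex_banach fps"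
    and G :: "complex set"
    and u :: "complex \<Rightarrow> 'f"
  assumes "k > 0"
    and "strongly_regular M"
    and "is_msum M d uhat G u"
  shows "msummable M d (moment_integral (gamma_moment k) uhat) \<and>
         (\<forall>H F. is_msum M d (moment_integral (gamma_moment k) uhat) H F \<longrightarrow>
                has_moment_deriv M (gamma_moment k) d H F G u)"
proof (intro conjI allI impI)
  show "msummable M d (moment_integral (gamma_moment k) uhat)"
    using msummable_moment_integral[OF assms(1) _ _ assms(3)] assms(2)
    by (simp add: strongly_regular_def)
next
  fix H F
  assume "is_msum M d (moment_integral (gamma_moment k) uhat) H F"
  \<comment> \<open>The witness in \<open>has_moment_deriv\<close> is the moment integral itself:
    \<open>F\<close> is a sum of it by assumption, and its moment derivative is \<open>uhat\<close>,
    with sum \<open>u\<close>.\<close>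
  moreover have "moment_deriv (gamma_moment k) (moment_integral (gamma_moment k) uhat) = uhat"
    using gamma_moment_pos[OF assms(1)] by (intro moment_deriv_moment_integral) (metis less_irrefl)
  ultimately show "has_moment_deriv M (gamma_moment k) d H F G u"
    using assms(3) unfolding has_moment_deriv_def by metis
qed

end
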